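(* There is an absolute constant $C>0$ such that the following holds. Let $k\geq 1$ be an integer, let $I\subset\mathbb{R}$ be an interval, let $f:I\to\mathbb{R}$ be $k$-convex on $I$, and let $A\subset I$ be a finite set with $|A|>10k$. Suppose $K>0$ is such that $|A+A-A|\leq K|A|$. Then \[ |2^kf(A)-(2^{k}-1)f(A)|\geq \frac{|A|^{k+1}}{(CK)^{2^{k+1}-k-2}(\log |A|)^{2^{k+2}-k-4}}. \]
   Context: For a set $X\subset\mathbb{R}$ and nonnegative integers $m,n$, $mX-nX=\{(x_1+\cdots+x_m)-(x_{m+1}+\cdots+x_{m+n}):x_1,\ldots,x_{m+n}\in X\}$; $A+A-A=2A-A$. $f(A)=\{f(a):a\in A\}$. A function $f$ on an interval $I$ is called $k$-convex on $I$ (for an integer $k\ge 0$) if each of the derivatives $f^{(1)},f^{(2)},\ldots,f^{(k+1)}$ exists and is non-vanishing on $I$. *)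

theory Defs
  imports "HOL-Analysis.Analysis"
begin

definition sumdiff :: "nat \<Rightarrow> nat \<Rightarrow> real set \<Rightarrow> real set" where
  "sumdiff m n X = {(\<Sum>i<m. x i) - (\<Sum>i<n. y i) | x y.
      (\<forall>i<m. x i \<in> X) \<and> (\<forall>i<n. y i \<in> X)}"

definition k_convex :: "nat \<Rightarrow> (real \<Rightarrow> real) \<Rightarrow> real set \<Rightarrow> bool" where
  "k_convex k f I \<longleftrightarrow> (\<exists>D :: nat \<Rightarrow> real \<Rightarrow> real.
      (\<forall>x\<in>I. D 0 x = f x) \<and>
      (\<forall>j\<le>k. \<forall>x\<in>I. (D j has_real_derivative D (Suc j) x) (at x within I)) \<and>
      (\<forall>j\<in>{1..k+1}. \<forall>x\<in>I. D j x \<noteq> 0))"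

end

theory Submission
  imports Defs
begin

text \<open>
  Induction on \<open>k\<close>, counting only those elements of \<open>2\<^sup>k f(A) - (2\<^sup>k - 1) f(A)\<close> that lie between
  \<open>min f(A)\<close> and \<open>max f(A)\<close>. Say \<open>f\<close> is increasing. Most pairs of neighbours \<open>a < a'\<close> in \<open>A\<close> enclose
  at most \<open>4K\<close> elements of \<open>A + A - A\<close>, and such good gaps have at most \<open>4K\<close> different lengths. For
  a fixed length \<open>d\<close>, the function \<open>f\<^sub>d(x) = f(x + d) - f(x)\<close> is positive and \<open>(k - 1)\<close>-convex. Split
  the left ends of the good gaps of length \<open>d\<close> at the median of \<open>f\<^sub>d\<close> into a lower half \<open>L\<close> and an
  upper half \<open>U\<close>, and apply the induction hypothesis to \<open>f\<^sub>d\<close> on \<open>L\<close>. The elements \<open>s\<close> obtained satisfy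
  \<open>0 < s \<le> f\<^sub>d(a)\<close> for every \<open>a \<in> U\<close>, so \<open>f(a) + s\<close> lies in \<open>(f(a), f(a + d)]\<close>. These intervals are
  disjoint, so the counts may be added over all \<open>a\<close> and \<open>d\<close>. The bound obtained has no logarithmic
  factor; for \<open>|A| > 10\<close> the logarithm exceeds \<open>1\<close> and only weakens it.
\<close>

section \<open>Iterated sums and differences of a set\<close>

lemma sumdiff_add:
  assumes "u \<in> sumdiff m n X" "v \<in> sumdiff m' n' X"
  shows "u + v \<in> sumdiff (m + m') (n + n') X"
proof -
  have split: "(\<Sum>i<p + q. if i < p then g i else h (i - p)) = (\<Sum>i<p. g i) + (\<Sum>i<q. h i)"
    for p q :: nat and g h :: "nat \<Rightarrow> real"
    by (induction q) simp_all
  obtain x y where xy: "u = (\<Sum>i<m. x i) - (\<Sum>i<n. y i)" "\<forall>i<m. x i \<in> X" "\<forall>i<n. y i \<in> X"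
    using assms(1) unfolding sumdiff_def by blast
  obtain x' y' where xy': "v = (\<Sum>i<m'. x' i) - (\<Sum>i<n'. y' i)" "\<forall>i<m'. x' i \<in> X" "\<forall>i<n'. y' i \<in> X"
    using assms(2) unfolding sumdiff_def by blast
  let ?x = "\<lambda>i. if i < m then x i else x' (i - m)"
  let ?y = "\<lambda>i. if i < n then y i else y' (i - n)"
  have "u + v = (\<Sum>i<m + m'. ?x i) - (\<Sum>i<n + n'. ?y i)"
    by (simp add: split xy xy')
  moreover have "\<forall>i<m + m'. ?x i \<in> X" "\<forall>i<n + n'. ?y i \<in> X"
    using xy xy' by auto
  ultimately show ?thesis
    unfolding sumdiff_def by blast
qed

text \<open>Each of the \<open>m\<close> added differences gives one plus term and one minus term,
  and each of the \<open>n\<close> subtracted ones does so with the roles of \<open>g\<close> and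
  \<open>h\<close> exchanged. This turns sums of values of a difference function into sums of values
  of the original function.\<close>

lemma sumdiff_diff:
  assumes "\<And>z. z \<in> L \<Longrightarrow> g z \<in> X \<and> h z \<in> X" "u \<in> sumdiff m n ((\<lambda>z. g z - h z) ` L)"
  shows "u \<in> sumdiff (m + n) (m + n) X"
proof -
  obtain x y where xy: "u = (\<Sum>i<m. x i) - (\<Sum>i<n. y i)"
    "\<forall>i<m. x i \<in> (\<lambda>z. g z - h z) ` L" "\<forall>i<n. y i \<in> (\<lambda>z. g z - h z) ` L"
    using assms(2) unfolding sumdiff_def by blast
  obtain x' where x': "\<forall>i<m. x' i \<in> L \<and> x i = g (x' i) - h (x' i)"
    using xy(2) unfolding image_iff Bex_def by metis
  obtain y' where y': "\<forall>i<n. y' i \<in> L \<and> y i = g (y' i) - h (y' i)"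
    using xy(3) unfolding image_iff Bex_def by metis
  have "(\<Sum>i<m. g (x' i)) - (\<Sum>i<m. h (x' i)) \<in> sumdiff m m X"
    using x' assms(1) unfolding sumdiff_def by blast
  moreover have "(\<Sum>i<n. h (y' i)) - (\<Sum>i<n. g (y' i)) \<in> sumdiff n n X"
    using y' assms(1) unfolding sumdiff_def by blast
  moreover have "u = ((\<Sum>i<m. g (x' i)) - (\<Sum>i<m. h (x' i))) + ((\<Sum>i<n. h (y' i)) - (\<Sum>i<n. g (y' i)))"
    using x' y' by (simp add: xy(1) sum_subtractf)
  ultimately show ?thesis
    using sumdiff_add by metis
qed

text \<open>The index functions matter only below \<open>m\<close> and \<open>n\<close>; restricted
  there, they range over finite function spaces.\<close>

lemma finite_sumdiff:
  assumes "finite X"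
  shows "finite (sumdiff m n X)"
proof (rule finite_subset)
  show "finite ((\<lambda>(x, y). (\<Sum>i<m. x i) - (\<Sum>i<n. y i)) `
      (({..<m} \<rightarrow>\<^sub>E X) \<times> ({..<n} \<rightarrow>\<^sub>E X)))"
    using assms by (intro finite_imageI finite_cartesian_product finite_PiE) auto
  show "sumdiff m n X \<subseteq> (\<lambda>(x, y). (\<Sum>i<m. x i) - (\<Sum>i<n. y i)) `
      (({..<m} \<rightarrow>\<^sub>E X) \<times> ({..<n} \<rightarrow>\<^sub>E X))"
  proof
    fix u assume "u \<in> sumdiff m n X"
    then obtain x y where xy: "u = (\<Sum>i<m. x i) - (\<Sum>i<n. y i)" "\<forall>i<m. x i \<in> X" "\<forall>i<n. y i \<in> X"
      unfolding sumdiff_def by blast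
    then show "u \<in> (\<lambda>(x, y). (\<Sum>i<m. x i) - (\<Sum>i<n. y i)) `
      (({..<m} \<rightarrow>\<^sub>E X) \<times> ({..<n} \<rightarrow>\<^sub>E X))"
      by (intro image_eqI[where x = "(restrict x {..<m}, restrict y {..<n})"]) auto
  qed
qed

lemma sumdiff_mono: "X \<subseteq> Y \<Longrightarrow> sumdiff m n X \<subseteq> sumdiff m n Y"
  unfolding sumdiff_def by blast

lemma subset_sumdiff: "X \<subseteq> sumdiff (Suc n) n X"
proof
  fix x assume "x \<in> X"
  then show "x \<in> sumdiff (Suc n) n X"
    unfolding sumdiff_def by (intro CollectI exI[of _ "\<lambda>_. x"]) (auto simp: algebra_simps)
qed

lemma sumdiff_1_0: "sumdiff (Suc 0) 0 X = X"
  by (force simp: sumdiff_def)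

lemma sumdiff_2_1:
  assumes "a \<in> X" "b \<in> X" "c \<in> X"
  shows "a + b - c \<in> sumdiff 2 1 X"
  unfolding sumdiff_def using assms
  by (intro CollectI exI[of _ "\<lambda>i. if i = 0 then a else b"] exI[of _ "\<lambda>_. c"])
    (auto simp: numeral_2_eq_2)

lemma uminus_sumdiff: "uminus ` sumdiff m n X \<subseteq> sumdiff m n (uminus ` X)"
proof
  fix u assume "u \<in> uminus ` sumdiff m n X"
  then obtain x y where "u = - ((\<Sum>i<m. x i) - (\<Sum>i<n. y i))" "\<forall>i<m. x i \<in> X" "\<forall>i<n. y i \<in> X"
    unfolding sumdiff_def by blast
  then show "u \<in> sumdiff m n (uminus ` X)"
    unfolding sumdiff_def
    by (intro CollectI exI[of _ "\<lambda>i. - x i"] exI[of _ "\<lambda>i. - y i"]) (auto simp: sum_negf)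
qed

lemma sumdiff_uminus: "sumdiff m n (uminus ` X) = uminus ` sumdiff m n X"
proof
  show "sumdiff m n (uminus ` X) \<subseteq> uminus ` sumdiff m n X"
    using image_mono[OF uminus_sumdiff[of m n "uminus ` X"], of uminus]
    by (simp add: image_image)
qed (rule uminus_sumdiff)

section \<open>Splitting a finite set at a median\<close>

text \<open>The cut is the least value \<open>v\<close> of \<open>g\<close> such that at least half
  of \<open>S\<close> has \<open>g s \<le> v\<close>. By minimality less than half of
  \<open>S\<close> lies strictly below \<open>v\<close>, so at least half lies at or above it.
  Elements with value exactly \<open>v\<close> go to both sides, so \<open>L\<close> and
  \<open>U\<close> may overlap.\<close>

lemma median_split:
  fixes g :: "'a \<Rightarrow> 'b :: linorder"
  assumes "finite S"
  obtains L U where "L \<subseteq> S" "U \<subseteq> S" "card S \<le> 2 * card L" "card S \<le> 2 * card U"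
    "\<And>l u. l \<in> L \<Longrightarrow> u \<in> U \<Longrightarrow> g l \<le> g u"
proof (cases "S = {}")
  case True
  then show ?thesis using that[of "{}" "{}"] by simp
next
  case False
  define low where "low v = {s \<in> S. g s \<le> v}" for v
  define V where "V = {v \<in> g ` S. card S \<le> 2 * card (low v)}"
  have "low (Max (g ` S)) = S"
    unfolding low_def using assms by auto
  then have "Max (g ` S) \<in> V"
    unfolding V_def using assms False by auto
  have "finite V"
    using assms by (simp add: V_def)
  with \<open>Max (g ` S) \<in> V\<close> have "Min V \<in> V"
    by (intro Min_in) auto
  have "card S \<le> 2 * card {s \<in> S. Min V \<le> g s}"
  proof (cases "\<exists>s\<in>S. g s < Min V")
    case True
    \<comment> \<open>Being the largest value below \<open>Min V\<close>, \<open>w\<close> has every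
      element below the cut in \<open>low w\<close>, and \<open>w\<close> is outside
      \<open>V\<close> by minimality.\<close>
    define w where "w = Max (g ` {s \<in> S. g s < Min V})"
    have "w \<in> g ` {s \<in> S. g s < Min V}"
      unfolding w_def using assms True by (intro Max_in) auto
    then have w: "w \<in> g ` S" "w < Min V"
      by auto
    then have "w \<notin> V"
      using Min_le[OF \<open>finite V\<close>] by fastforce
    then have "2 * card (low w) < card S"
      using w by (auto simp: V_def)
    moreover have "{s \<in> S. g s < Min V} \<subseteq> low w"
      unfolding low_def w_def using assms by auto
    then have "card {s \<in> S. g s < Min V} \<le> card (low w)"
      using assms by (intro card_mono) (auto simp: low_def)
    moreover have "card S = card {s \<in> S. g s < Min V} + card {s \<in> S. Min V \<le> g s}"
      using assms by (subst card_Un_disjoint[symmetric]) (auto intro!: arg_cong[where f = card])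
    ultimately show ?thesis by simp
  next
    case False
    then have "{s \<in> S. Min V \<le> g s} = S"
      by auto
    then show ?thesis by simp
  qed
  with \<open>Min V \<in> V\<close> show ?thesis
    by (intro that[of "low (Min V)" "{s \<in> S. Min V \<le> g s}"]) (auto simp: V_def low_def)
qed

section \<open>Monotonicity and shifts of convex functions\<close>

text \<open>By the mean value theorem, equal values at two points would force a zero of the first
  derivative between them. Together with continuity this yields strict monotonicity on the
  interval.\<close>

lemma k_convex_inj_on:
  assumes "is_interval I" "k_convex k f I"
  shows "inj_on f I" "continuous_on I f"
proof -
  obtain D where D0: "\<forall>x\<in>I. D 0 x = f x" and
    D: "\<forall>j\<le>k. \<forall>x\<in>I. (D j has_real_derivative D (Suc j) x) (at x within I)" and
    nz: "\<forall>j\<in>{1..k+1}. \<forall>x\<in>I. D j x \<noteq> 0"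
    using assms(2) unfolding k_convex_def by blast
  have der: "(f has_real_derivative D 1 x) (at x within I)" if "x \<in> I" for x
    using D0 D that
    by (intro has_field_derivative_transform_within[of "D 0" "D 1 x" x I 1 f]) auto
  then show "continuous_on I f"
    by (rule DERIV_continuous_on)
  have neq: "f x \<noteq> f y" if "x \<in> I" "y \<in> I" "x < y" for x y
  proof -
    have sub: "{x..y} \<subseteq> I"
      using mem_is_interval_1_I[OF assms(1) that(1,2)] by auto
    have "(f has_derivative (*) (D 1 z)) (at z within {x..y})" if "x \<le> z" "z \<le> y" for z
      using has_field_derivative_subset[OF der sub] that sub
      by (auto simp: has_field_derivative_def)
    then obtain z where "z \<in> {x<..<y}" "f y - f x = D 1 z * (y - x)"
      using mvt_simple[of x y f "\<lambda>z. (*) (D 1 z)"] \<open>x < y\<close> by blast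
    moreover from this have "z \<in> I"
      using sub by force
    then have "D 1 z \<noteq> 0"
      using nz by simp
    ultimately show ?thesis
      using that by auto
  qed
  show "inj_on f I"
    by (intro inj_onI) (metis neq linorder_neqE)
qed

lemma k_convex_uminus:
  assumes "k_convex k f I"
  shows "k_convex k (\<lambda>x. - f x) I"
proof -
  obtain D where "\<forall>x\<in>I. D 0 x = f x" 
    "\<forall>j\<le>k. \<forall>x\<in>I. (D j has_real_derivative D (Suc j) x) (at x within I)"
    "\<forall>j\<in>{1..k+1}. \<forall>x\<in>I. D j x \<noteq> 0"
    using assms unfolding k_convex_def by blast
  then show ?thesis
    unfolding k_convex_def
    by (intro exI[of _ "\<lambda>j x. - D j x"]) (auto intro: DERIV_minus)
qed

lemma is_interval_shift:
  fixes I :: "real set"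
  assumes "is_interval I"
  shows "is_interval {x \<in> I. x + d \<in> I}"
  using assms unfolding is_interval_1 by (smt (verit) mem_Collect_eq)

text \<open>The derivatives of the shifted difference are the differences of the derivatives
  \<open>D j\<close>. These are nonzero because \<open>D j\<close> is injective, which uses that
  \<open>D (Suc j)\<close> does not vanish; hence one order of convexity is lost.\<close>

lemma k_convex_shift:
  assumes "is_interval I" "k_convex (Suc k) f I" "d > 0"
  shows "k_convex k (\<lambda>x. f (x + d) - f x) {x \<in> I. x + d \<in> I}"
proof -
  let ?J = "{x \<in> I. x + d \<in> I}"
  obtain D where D0: "\<forall>x\<in>I. D 0 x = f x" and
    D: "\<forall>j\<le>Suc k. \<forall>x\<in>I. (D j has_real_derivative D (Suc j) x) (at x within I)" and
    nz: "\<forall>j\<in>{1..Suc k+1}. \<forall>x\<in>I. D j x \<noteq> 0"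
    using assms(2) unfolding k_convex_def by blast
  have "((\<lambda>x. D j (x + d) - D j x) has_real_derivative D (Suc j) (x + d) - D (Suc j) x)
      (at x within ?J)" if "j \<le> k" "x \<in> ?J" for j x
  proof (rule DERIV_diff)
    show "(D j has_real_derivative D (Suc j) x) (at x within ?J)"
      using D that by (intro has_field_derivative_subset[of _ _ x I ?J]) auto
    have "(D j has_real_derivative D (Suc j) (x + d)) (at (x + d) within (\<lambda>x. x + d) ` ?J)"
      using D that by (intro has_field_derivative_subset[of _ _ "x + d" I "(\<lambda>x. x + d) ` ?J"]) auto
    then have "(D j \<circ> (\<lambda>x. x + d) has_real_derivative D (Suc j) (x + d) * 1) (at x within ?J)"
      by (rule DERIV_image_chain) (auto intro!: derivative_eq_intros)
    then show "((\<lambda>x. D j (x + d)) has_real_derivative D (Suc j) (x + d)) (at x within ?J)"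
      by (simp add: o_def)
  qed
  moreover have "D j (x + d) - D j x \<noteq> 0" if "j \<in> {1..k+1}" "x \<in> ?J" for j x
  proof -
    have "k_convex 0 (D j) I"
      unfolding k_convex_def using D nz that
      by (intro exI[of _ "\<lambda>i. D (j + i)"]) auto
    then have "inj_on (D j) I"
      using k_convex_inj_on assms(1) by blast
    then show ?thesis
      using that assms(3) by (auto dest: inj_onD)
  qed
  ultimately show ?thesis
    unfolding k_convex_def using D0
    by (intro exI[of _ "\<lambda>j x. D j (x + d) - D j x"]) auto
qed

section \<open>Sums between the extreme elements\<close>

text \<open>Counting only sums between the extremes strengthens the claim so that it can be
  iterated: sums built from a difference function then stay between two of its values, and can be
  placed inside a single gap.\<close>

definition squeezed :: "nat \<Rightarrow> real set \<Rightarrow> real set" where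
  "squeezed k X = sumdiff (2^k) (2^k - 1) X \<inter> {Min X..Max X}"

lemma finite_squeezed: "finite X \<Longrightarrow> finite (squeezed k X)"
  by (simp add: squeezed_def finite_sumdiff)

lemma subset_squeezed:
  assumes "finite X"
  shows "X \<subseteq> squeezed k X"
  using subset_sumdiff[of X "2^k - 1"] assms by (auto simp: squeezed_def)

text \<open>Negation exchanges minimum and maximum. This reduces decreasing functions to increasing
  ones.\<close>

lemma card_squeezed_uminus:
  assumes "finite X" "X \<noteq> {}"
  shows "card (squeezed k (uminus ` X)) = card (squeezed k X)"
proof -
  have "squeezed k (uminus ` X) = uminus ` squeezed k X"
    unfolding squeezed_def sumdiff_uminus minus_Min_eq_Max[OF assms, symmetric]
      minus_Max_eq_Min[OF assms, symmetric] by (simp add: image_Int)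
  then show ?thesis
    by (simp add: card_image)
qed

section \<open>The induction step for increasing functions\<close>

text \<open>The hypothesis must hold for every constant, since it is applied to a subset
  \<open>L\<close> with \<open>K * n / card L\<close> in place of \<open>K\<close>. The new exponent
  \<open>2 * e + k + 1\<close> is \<open>e\<close> from that application plus
  \<open>k + 1 + e\<close> from averaging over at most \<open>4 * K\<close> gap lengths.\<close>

lemma squeeze_step:
  fixes K :: real
  assumes IH: "\<And>g J B (K :: real). is_interval J \<Longrightarrow> k_convex k g J \<Longrightarrow> finite B \<Longrightarrow> B \<noteq> {} \<Longrightarrow> B \<subseteq> J \<Longrightarrow>
      real (card (sumdiff 2 1 B)) \<le> K * card B \<Longrightarrow>
      real (card B) ^ (k + 1) \<le> (1024 * K) ^ e * card (squeezed k (g ` B))"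
    and "is_interval I" "k_convex (Suc k) f I" "strict_mono_on I f"
    and "finite A" "A \<noteq> {}" "A \<subseteq> I" and T: "real (card (sumdiff 2 1 A)) \<le> K * card A"
  shows "real (card A) ^ (k + 2) \<le> (1024 * K) ^ (2 * e + k + 1) * card (squeezed (Suc k) (f ` A))"
proof -
  define n where "n = real (card A)"
  define T where "T = sumdiff 2 1 A"
  define q where "q = real (card (squeezed (Suc k) (f ` A)))"
  have "finite T"
    unfolding T_def using \<open>finite A\<close> by (rule finite_sumdiff)
  have "n \<ge> 1"
    using \<open>finite A\<close> \<open>A \<noteq> {}\<close> by (simp add: n_def Suc_le_eq card_gt_0_iff)
  have "A \<subseteq> T"
    using subset_sumdiff[of A 1] by (simp add: T_def numeral_2_eq_2)
  then have "n \<le> K * n"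
    using T card_mono[OF \<open>finite T\<close> \<open>A \<subseteq> T\<close>] by (simp add: n_def T_def)
  then have "K \<ge> 1"
    using \<open>n \<ge> 1\<close> by simp
  have "card (f ` A) \<le> card (squeezed (Suc k) (f ` A))"
    using \<open>finite A\<close> by (intro card_mono finite_squeezed subset_squeezed) auto
  moreover have "card (f ` A) \<ge> 1"
    using \<open>finite A\<close> \<open>A \<noteq> {}\<close> by (simp add: Suc_le_eq card_gt_0_iff)
  ultimately have "q \<ge> 1"
    by (simp add: q_def)
  have "n ^ (k + 2) \<le> (1024 * K) ^ (2 * e + k + 1) * q"
  proof (cases "card A = 1")
    case True
    \<comment> \<open>A single point has no gaps, but both factors on the right are at least
      1.\<close>
    have "1 * 1 \<le> (1024 * K) ^ (2 * e + k + 1) * q"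
      using \<open>K \<ge> 1\<close> \<open>q \<ge> 1\<close> by (intro mult_mono one_le_power) auto
    then show ?thesis
      using True by (simp add: n_def)
  next
    case False
    then have "n \<ge> 2"
      using \<open>n \<ge> 1\<close> by (simp add: n_def)
    define B where "B = A - {Max A}"
    have "finite B"
      using \<open>finite A\<close> by (simp add: B_def)
    have card_B: "real (card B) = n - 1"
      using \<open>finite A\<close> \<open>A \<noteq> {}\<close> \<open>n \<ge> 1\<close> by (simp add: B_def n_def card_Diff_singleton of_nat_diff)
    define nxt where "nxt a = Min {b \<in> A. a < b}" for a
    have nxt: "nxt a \<in> A" "a < nxt a" if "a \<in> B" for a
    proof -
      have "Max A \<in> {b \<in> A. a < b}"
        using that \<open>finite A\<close> \<open>A \<noteq> {}\<close> by (auto simp: B_def less_le)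
      then have "nxt a \<in> {b \<in> A. a < b}"
        unfolding nxt_def using \<open>finite A\<close> by (intro Min_in) auto
      then show "nxt a \<in> A" "a < nxt a"
        by auto
    qed
    have nxt_le: "nxt a \<le> b" if "b \<in> A" "a < b" for a b
      unfolding nxt_def using that \<open>finite A\<close> by (intro Min_le) auto
    have f_less: "f x < f y \<longleftrightarrow> x < y" if "x \<in> A" "y \<in> A" for x y
      using that \<open>A \<subseteq> I\<close> \<open>strict_mono_on I f\<close> by (meson strict_mono_on_less subsetD)
    have f_le: "f x \<le> f y \<longleftrightarrow> x \<le> y" if "x \<in> A" "y \<in> A" for x y
      using f_less that by (meson not_le)
    \<comment> \<open>Half-open intervals keep a common endpoint of adjacent gaps from being counted
      twice. The map \<open>h\<close> is the identity when counting in \<open>T\<close> and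
      \<open>f\<close> when counting sums of values.\<close>
    have disj: "{h a<..h (nxt a)} \<inter> {h b<..h (nxt b)} = {}"
      if "a \<in> B" "b \<in> B" "a \<noteq> b" and h: "\<And>x y. x \<in> A \<Longrightarrow> y \<in> A \<Longrightarrow> x \<le> y \<Longrightarrow> h x \<le> h y"
      for a b and h :: "real \<Rightarrow> real"
    proof -
      have "h (nxt a) \<le> h b \<or> h (nxt b) \<le> h a"
        using that nxt nxt_le by (metis B_def DiffD1 linorder_neqE)
      then show ?thesis
        by auto
    qed
    have sum_le: "(\<Sum>a\<in>B. card (Z \<inter> {h a<..h (nxt a)})) \<le> card Z'"
      if "finite Z'" "\<And>a. a \<in> B \<Longrightarrow> Z \<inter> {h a<..h (nxt a)} \<subseteq> Z'"
        and h: "\<And>x y. x \<in> A \<Longrightarrow> y \<in> A \<Longrightarrow> x \<le> y \<Longrightarrow> h x \<le> h y"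
      for Z Z' and h :: "real \<Rightarrow> real"
    proof -
      have "(\<Sum>a\<in>B. card (Z \<inter> {h a<..h (nxt a)})) = card (\<Union>a\<in>B. Z \<inter> {h a<..h (nxt a)})"
      proof (rule card_UN_disjoint[symmetric])
        show "\<forall>a\<in>B. finite (Z \<inter> {h a<..h (nxt a)})"
          using that finite_subset by blast
        show "\<forall>a\<in>B. \<forall>b\<in>B. a \<noteq> b \<longrightarrow>
            Z \<inter> {h a<..h (nxt a)} \<inter> (Z \<inter> {h b<..h (nxt b)}) = {}"
          using disj[of _ _ h] h by blast
      qed fact
      also have "\<dots> \<le> card Z'"
        using that by (intro card_mono) auto
      finally show ?thesis .
    qed
    \<comment> \<open>The gap intervals are disjoint and \<open>T\<close> has at most
      \<open>K * n\<close> elements, so at most \<open>n / 4\<close> gaps can contain more than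
      \<open>4 * K\<close> of them.\<close>
    define G where "G = {a \<in> B. card (T \<inter> {a<..nxt a}) \<le> 4 * K}"
    have "finite G" "G \<subseteq> B"
      using \<open>finite B\<close> by (auto simp: G_def)
    have "4 * K * card (B - G) = (\<Sum>a\<in>B - G. 4 * K)"
      by simp
    also have "\<dots> \<le> (\<Sum>a\<in>B - G. real (card (T \<inter> {a<..nxt a})))"
      by (intro sum_mono) (auto simp: G_def)
    also have "\<dots> \<le> (\<Sum>a\<in>B. real (card (T \<inter> {a<..nxt a})))"
      using \<open>finite B\<close> by (intro sum_mono2) auto
    also have "\<dots> \<le> card T"
      using sum_le[of T T "\<lambda>x. x"] \<open>finite T\<close> by (simp flip: of_nat_sum)
    also have "\<dots> \<le> K * n"
      using T by (simp add: T_def n_def)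
    finally have "card (B - G) \<le> n / 4"
      using \<open>K \<ge> 1\<close> by (simp add: field_simps)
    moreover have "real (card (B - G)) = n - 1 - card G"
      using \<open>finite G\<close> \<open>G \<subseteq> B\<close> \<open>finite B\<close> card_B card_mono[of B G]
      by (simp add: card_Diff_subset of_nat_diff)
    \<comment> \<open>At least \<open>n - 1 - n / 4\<close> gaps are good, and this is at least
      \<open>n / 4\<close> exactly when \<open>n \<ge> 2\<close>.\<close>
    ultimately have card_G: "card G \<ge> n / 4"
      using \<open>n \<ge> 2\<close> by simp
    then have "G \<noteq> {}"
      using \<open>n \<ge> 2\<close> by auto
    define gap where "gap a = nxt a - a" for a
    define D where "D = gap ` G"
    have "finite D"
      using \<open>finite G\<close> by (simp add: D_def)
    \<comment> \<open>Translating by the left end of the longest good gap embeds all good gap lengths into \<open>T\<close>.\<close>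
    have card_D: "card D \<le> 4 * K"
    proof -
      have "Max D \<in> D"
        using \<open>finite D\<close> \<open>G \<noteq> {}\<close> by (intro Max_in) (auto simp: D_def)
      then obtain c where c: "c \<in> G" "gap c = Max D"
        by (auto simp: D_def)
      have "(+) c ` D \<subseteq> T \<inter> {c<..nxt c}"
      proof safe
        fix d assume "d \<in> D"
        then obtain a where a: "a \<in> G" "d = gap a"
          by (auto simp: D_def)
        have "c + nxt a - a \<in> T"
          unfolding T_def using a c \<open>G \<subseteq> B\<close> nxt by (intro sumdiff_2_1) (auto simp: B_def)
        then show "c + d \<in> T"
          using a by (simp add: gap_def add_diff_eq)
        have "d \<le> gap c"
          using c \<open>d \<in> D\<close> \<open>finite D\<close> by simp
        then show "c + d \<in> {c<..nxt c}"
          using a nxt[of a] \<open>G \<subseteq> B\<close> by (auto simp: gap_def)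
      qed
      then have "card ((+) c ` D) \<le> card (T \<inter> {c<..nxt c})"
        using \<open>finite T\<close> by (intro card_mono) auto
      moreover have "card ((+) c ` D) = card D"
        by (intro card_image) auto
      ultimately show ?thesis
        using c(1) by (simp add: G_def)
    qed
    define W where "W a = sumdiff (2^Suc k) (2^Suc k - 1) (f ` A) \<inter> {f a<..f (nxt a)}" for a
    have "(\<Sum>a\<in>B. card (W a)) \<le> card (squeezed (Suc k) (f ` A))"
      unfolding W_def
    proof (rule sum_le)
      fix a assume "a \<in> B"
      then have "Min (f ` A) \<le> f a" "f (nxt a) \<le> Max (f ` A)"
        using nxt \<open>finite A\<close> by (auto simp: B_def)
      then show "sumdiff (2^Suc k) (2^Suc k - 1) (f ` A) \<inter> {f a<..f (nxt a)} \<subseteq> squeezed (Suc k) (f ` A)"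
        by (auto simp: squeezed_def)
    qed (use \<open>finite A\<close> f_le in \<open>auto intro: finite_squeezed\<close>)
    then have sum_W: "(\<Sum>a\<in>B. real (card (W a))) \<le> q"
      unfolding q_def by (simp flip: of_nat_sum)
    define S where "S d = {a \<in> G. gap a = d}" for d
    \<comment> \<open>Half the size of the class bounds both \<open>card L\<close> and
      \<open>card U\<close> from below.\<close>
    define m where "m d = real (card (S d)) / 2" for d
    have m_le: "m d ^ (k + 2 + e) \<le> (1024 * (K * n)) ^ e * (\<Sum>a\<in>S d. real (card (W a)))"
      if "d \<in> D" for d
    proof -
      have "finite (S d)" "S d \<subseteq> G" "S d \<noteq> {}"
        using \<open>finite G\<close> that by (auto simp: S_def D_def)
      have S: "x \<in> A" "x + d \<in> A" "nxt x = x + d" if "x \<in> S d" for x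
      proof -
        have "x \<in> B" "gap x = d"
          using that \<open>G \<subseteq> B\<close> by (auto simp: S_def)
        then show "x \<in> A" "x + d \<in> A" "nxt x = x + d"
          using nxt(1)[of x] by (auto simp: gap_def B_def)
      qed
      have "d > 0"
        using that nxt(2) \<open>G \<subseteq> B\<close> by (auto simp: D_def gap_def)
      define g where "g x = f (x + d) - f x" for x
      obtain L U where "L \<subseteq> S d" "U \<subseteq> S d" and cardLU: "card (S d) \<le> 2 * card L" "card (S d) \<le> 2 * card U"
        and LU: "\<And>l u. l \<in> L \<Longrightarrow> u \<in> U \<Longrightarrow> g l \<le> g u"
        using median_split[OF \<open>finite (S d)\<close>, of g] by metis
      have "finite L" "finite U"
        using \<open>L \<subseteq> S d\<close> \<open>U \<subseteq> S d\<close> \<open>finite (S d)\<close> finite_subset by blast+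
      have "card (S d) > 0"
        using \<open>finite (S d)\<close> \<open>S d \<noteq> {}\<close> by (simp add: card_gt_0_iff)
      then have "card L > 0"
        using cardLU by linarith
      then have "L \<noteq> {}"
        by auto
      define Q where "Q = squeezed k (g ` L)"
      \<comment> \<open>The sums \<open>L + L - L\<close> lie in \<open>T\<close>, so their number
        is at most \<open>K * n\<close>, which is \<open>K * n / card L\<close> times
        \<open>card L\<close>.\<close>
      have "real (card L) ^ (k + 1) \<le> (1024 * (K * n / card L)) ^ e * card Q"
        unfolding Q_def
      proof (rule IH)
        show "k_convex k g {x \<in> I. x + d \<in> I}"
          unfolding g_def using k_convex_shift assms(2,3) \<open>d > 0\<close> by blast
        show "L \<subseteq> {x \<in> I. x + d \<in> I}"
          using \<open>L \<subseteq> S d\<close> S(1,2) \<open>A \<subseteq> I\<close> by blast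
        have "L \<subseteq> A"
          using \<open>L \<subseteq> S d\<close> S(1) by blast
        then have "card (sumdiff 2 1 L) \<le> card T"
          unfolding T_def using \<open>finite A\<close> by (intro card_mono finite_sumdiff sumdiff_mono)
        then show "real (card (sumdiff 2 1 L)) \<le> K * n / card L * card L"
          using T \<open>card L > 0\<close> by (simp add: T_def n_def)
      qed (use assms(2) is_interval_shift \<open>finite L\<close> \<open>L \<noteq> {}\<close> in auto)
      \<comment> \<open>Multiplying by the \<open>e\<close>-th power of \<open>card L\<close>
        removes it from the constant and raises the exponent on the left by
        \<open>e\<close>.\<close>
      then have L_le: "real (card L) ^ (k + 1 + e) \<le> (1024 * (K * n)) ^ e * card Q"
        using \<open>card L > 0\<close> by (simp add: power_add power_divide divide_simps mult_ac)
      have W_ge: "card Q \<le> card (W a)" if "a \<in> U" for a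
      proof -
        have a: "a \<in> A" "nxt a = a + d"
          using that \<open>U \<subseteq> S d\<close> S by auto
        have "(+) (f a) ` Q \<subseteq> W a"
        proof safe
          fix s assume "s \<in> Q"
          then have s: "s \<in> sumdiff (2^k) (2^k - 1) (g ` L)" "Min (g ` L) \<le> s" "s \<le> Max (g ` L)"
            by (auto simp: Q_def squeezed_def)
          have "Min (g ` L) \<in> g ` L" "Max (g ` L) \<in> g ` L"
            using \<open>finite L\<close> \<open>L \<noteq> {}\<close> by auto
          then obtain l l' where l: "l \<in> L" "g l \<le> s" and l': "l' \<in> L" "s \<le> g l'"
            using s by auto
          have "0 < g l"
            using l(1) \<open>L \<subseteq> S d\<close> S[of l] \<open>d > 0\<close> f_less by (auto simp: g_def)
          moreover have "s \<le> g a"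
            using l' LU that by force
          ultimately have "f a + s \<in> {f a<..f (nxt a)}"
            using l a by (simp add: g_def)
          \<comment> \<open>The \<open>2^k + (2^k - 1)\<close> differences give
            \<open>2^(k+1) - 1\<close> terms of each sign; the extra summand \<open>f a\<close>
            supplies the missing plus term.\<close>
          moreover have "s \<in> sumdiff (2^k + (2^k - 1)) (2^k + (2^k - 1)) (f ` A)"
            using s(1) \<open>L \<subseteq> S d\<close> S unfolding g_def by (intro sumdiff_diff[of L "\<lambda>x. f (x + d)" _ f]) auto
          moreover have "f a \<in> sumdiff (Suc 0) 0 (f ` A)"
            using a by (simp add: sumdiff_1_0)
          ultimately have "f a + s \<in> sumdiff (Suc 0 + (2^k + (2^k - 1))) (0 + (2^k + (2^k - 1))) (f ` A)"
            using sumdiff_add by blast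
          moreover have "Suc 0 + (2^k + (2^k - 1)) = (2::nat)^Suc k" "0 + (2^k + (2^k - 1)) = (2::nat)^Suc k - 1"
            by simp_all
          ultimately show "f a + s \<in> W a"
            using \<open>f a + s \<in> {f a<..f (nxt a)}\<close> unfolding W_def by (metis IntI)
        qed
        then have "card ((+) (f a) ` Q) \<le> card (W a)"
          using \<open>finite A\<close> by (intro card_mono) (auto simp: W_def finite_sumdiff)
        then show ?thesis
          by (simp add: card_image)
      qed
      have "real (card U) * card Q = (\<Sum>a\<in>U. real (card Q))"
        by simp
      also have "\<dots> \<le> (\<Sum>a\<in>U. real (card (W a)))"
        using W_ge by (intro sum_mono) auto
      also have "\<dots> \<le> (\<Sum>a\<in>S d. real (card (W a)))"
        using \<open>finite (S d)\<close> \<open>U \<subseteq> S d\<close> by (intro sum_mono2) auto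
      finally have UQ: "real (card U) * card Q \<le> (\<Sum>a\<in>S d. real (card (W a)))" .
      have "m d ^ (k + 2 + e) = m d ^ (k + 1 + e) * m d"
        by simp
      also have "\<dots> \<le> real (card L) ^ (k + 1 + e) * card U"
        using cardLU by (intro mult_mono power_mono) (auto simp: m_def)
      also have "\<dots> \<le> (1024 * (K * n)) ^ e * card Q * card U"
        by (intro mult_right_mono L_le) auto
      also have "\<dots> = (1024 * (K * n)) ^ e * (card U * card Q)"
        by simp
      also have "\<dots> \<le> (1024 * (K * n)) ^ e * (\<Sum>a\<in>S d. real (card (W a)))"
        using UQ \<open>K \<ge> 1\<close> \<open>n \<ge> 1\<close> by (intro mult_left_mono) auto
      finally show ?thesis .
    qed
    \<comment> \<open>The \<open>m d\<close> add up to at least \<open>n / 8\<close>. With at most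
      \<open>4 * K\<close> lengths, subtracting \<open>t\<close> for each costs at most
      \<open>n / 16\<close>, half of that.\<close>
    define t where "t = n / (64 * K)"
    have "t > 0"
      using \<open>n \<ge> 1\<close> \<open>K \<ge> 1\<close> by (simp add: t_def)
    \<comment> \<open>A linear minorant replaces the power mean inequality.\<close>
    have pow_ge: "t ^ (k + 1 + e) * (m d - t) \<le> m d ^ (k + 2 + e)" for d
    proof (cases "t \<le> m d")
      case True
      then have "t ^ (k + 1 + e) * (m d - t) \<le> m d ^ (k + 1 + e) * m d"
        using \<open>t > 0\<close> by (intro mult_mono power_mono) auto
      then show ?thesis
        by (simp add: mult_ac)
    next
      case False
      then have "t ^ (k + 1 + e) * (m d - t) \<le> 0"
        using \<open>t > 0\<close> by (intro mult_nonneg_nonpos) auto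
      also have "0 \<le> m d ^ (k + 2 + e)"
        by (simp add: m_def)
      finally show ?thesis .
    qed
    have sum_S: "(\<Sum>d\<in>D. \<Sum>a\<in>S d. h a) = (\<Sum>a\<in>G. h a)" for h :: "real \<Rightarrow> real"
      unfolding S_def D_def using \<open>finite G\<close> by (rule sum.image_gen[symmetric])
    have "(\<Sum>d\<in>D. m d) = card G / 2"
      using sum_S[of "\<lambda>_. 1"] by (simp add: m_def flip: sum_divide_distrib)
    moreover have "card D * t \<le> 4 * K * t"
      using card_D \<open>t > 0\<close> by (intro mult_right_mono) auto
    moreover have "4 * K * t = n / 16"
      using \<open>K \<ge> 1\<close> by (simp add: t_def)
    ultimately have "n / 16 \<le> (\<Sum>d\<in>D. m d - t)"
      using card_G by (simp add: sum_subtractf)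
    then have "t ^ (k + 1 + e) * (n / 16) \<le> t ^ (k + 1 + e) * (\<Sum>d\<in>D. m d - t)"
      using \<open>t > 0\<close> by (intro mult_left_mono) auto
    also have "\<dots> \<le> (\<Sum>d\<in>D. m d ^ (k + 2 + e))"
      unfolding sum_distrib_left by (intro sum_mono pow_ge)
    also have "\<dots> \<le> (\<Sum>d\<in>D. (1024 * (K * n)) ^ e * (\<Sum>a\<in>S d. real (card (W a))))"
      by (intro sum_mono m_le)
    also have "\<dots> = (1024 * (K * n)) ^ e * (\<Sum>a\<in>G. real (card (W a)))"
      by (simp add: sum_S flip: sum_distrib_left)
    also have "\<dots> \<le> (1024 * (K * n)) ^ e * q"
    proof (rule mult_left_mono)
      have "(\<Sum>a\<in>G. real (card (W a))) \<le> (\<Sum>a\<in>B. real (card (W a)))"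
        using \<open>finite B\<close> \<open>G \<subseteq> B\<close> by (intro sum_mono2) auto
      then show "(\<Sum>a\<in>G. real (card (W a))) \<le> q"
        using sum_W by simp
    qed (use \<open>K \<ge> 1\<close> \<open>n \<ge> 1\<close> in auto)
    \<comment> \<open>On the left, \<open>t\<close> and the factor \<open>n / 16\<close> give
      \<open>n\<close> to the power \<open>k + 2 + e\<close>; the right side carries
      \<open>n ^ e\<close>, which cancels.\<close>
    finally have "n ^ e * n ^ (k + 2) \<le> n ^ e * (16 * (64 * K) ^ (k + 1 + e) * (1024 * K) ^ e * q)"
      using \<open>K \<ge> 1\<close> by (simp add: t_def power_divide divide_simps power_mult_distrib power_add mult_ac)
    then have "n ^ (k + 2) \<le> 16 * (64 * K) ^ (k + 1 + e) * (1024 * K) ^ e * q"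
      using \<open>n \<ge> 1\<close> by (subst (asm) mult_le_cancel_left_pos) auto
    \<comment> \<open>Since \<open>1024 = 16 * 64\<close> and the exponent is at least 1, the stray
      factor 16 is absorbed, and the constant does not grow with \<open>k\<close>.\<close>
    also have "\<dots> \<le> (1024 * K) ^ (k + 1 + e) * (1024 * K) ^ e * q"
    proof (intro mult_right_mono)
      have "1024 * K = 16 * (64 * K)"
        by simp
      have "(16::real) ^ 1 \<le> 16 ^ (k + 1 + e)"
        by (intro power_increasing) auto
      then have "16 * (64 * K) ^ (k + 1 + e) \<le> 16 ^ (k + 1 + e) * (64 * K) ^ (k + 1 + e)"
        using \<open>K \<ge> 1\<close> by (intro mult_right_mono) auto
      then show "16 * (64 * K) ^ (k + 1 + e) \<le> (1024 * K) ^ (k + 1 + e)"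
        unfolding \<open>1024 * K = 16 * (64 * K)\<close> power_mult_distrib[of 16 "64 * K"] .
    qed (use \<open>K \<ge> 1\<close> \<open>q \<ge> 1\<close> in auto)
    also have "\<dots> = (1024 * K) ^ (2 * e + k + 1) * q"
      unfolding power_add[symmetric] by (rule arg_cong[where f = "\<lambda>i. (1024 * K) ^ i * q"]) simp
    finally show ?thesis .
  qed
  then show ?thesis
    by (simp add: n_def q_def)
qed

section \<open>The bound without logarithms\<close>

text \<open>The exponent solves \<open>E (k+1) = 2 * E k + k + 1\<close> with
  \<open>E 0 = 0\<close>. The base case is injectivity of \<open>f\<close>.\<close>

lemma card_squeezed_ge:
  fixes K :: real
  assumes "is_interval I" "k_convex k f I" "finite A" "A \<noteq> {}" "A \<subseteq> I"
    and "real (card (sumdiff 2 1 A)) \<le> K * card A"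
  shows "real (card A) ^ (k + 1) \<le> (1024 * K) ^ (2^(k+1) - k - 2) * card (squeezed k (f ` A))"
  using assms
proof (induction k arbitrary: f I A K)
  case 0
  have "inj_on f A"
    using k_convex_inj_on(1) inj_on_subset 0 by metis
  moreover have "card (f ` A) \<le> card (squeezed 0 (f ` A))"
    using \<open>finite A\<close> by (intro card_mono finite_squeezed subset_squeezed) auto
  ultimately have "card A \<le> card (squeezed 0 (f ` A))"
    by (simp add: card_image)
  then show ?case
    by simp
next
  case (Suc k)
  \<comment> \<open>This keeps the natural-number subtraction in the exponent from
    truncating.\<close>
  have "k + 2 \<le> 2^(k+1)" for k :: nat
    by (induction k) auto
  from this[of k] have e: "2 * (2^(k+1) - k - 2) + k + 1 = 2^(Suc k + 1) - Suc k - (2::nat)"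
    by simp
  have step: "real (card A) ^ (k + 2) \<le>
      (1024 * K) ^ (2^(Suc k + 1) - Suc k - 2) * card (squeezed (Suc k) (g ` A))"
    if "k_convex (Suc k) g I" "strict_mono_on I g" for g
    using squeeze_step[of k "2^(k+1) - k - 2" I g A K] Suc.IH Suc.prems that unfolding e by blast
  have "strict_mono_on I f \<or> strict_antimono_on I f"
    using injective_eq_monotone_map k_convex_inj_on Suc.prems(1,2) by blast
  then show ?case
  proof
    assume "strict_mono_on I f"
    then show ?thesis
      using step[of f] Suc.prems by simp
  next
    assume anti: "strict_antimono_on I f"
    have "strict_mono_on I (\<lambda>x. - f x)"
      using anti by (auto simp: monotone_on_def)
    then have "real (card A) ^ (k + 2) \<le> (1024 * K) ^ (2^(Suc k + 1) - Suc k - 2) *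
        card (squeezed (Suc k) ((\<lambda>x. - f x) ` A))"
      using step[of "\<lambda>x. - f x"] Suc.prems k_convex_uminus by blast
    moreover have "(\<lambda>x. - f x) ` A = uminus ` (f ` A)"
      by auto
    ultimately show ?thesis
      using card_squeezed_uminus[of "f ` A" "Suc k"] Suc.prems by simp
  qed
qed

section \<open>Weakening by the logarithmic factor\<close>

theorem theorem4:
  shows "\<exists>C>0. \<forall>(k::nat) (I::real set) (f::real \<Rightarrow> real) (A::real set) (K::real).
     k \<ge> 1 \<and> is_interval I \<and> k_convex k f I \<and> finite A \<and> A \<subseteq> I \<and>
     card A > 10 * k \<and> K > 0 \<and> real (card (sumdiff 2 1 A)) \<le> K * real (card A) \<longrightarrow>
     real (card (sumdiff (2^k) (2^k - 1) (f ` A))) \<ge>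
       real (card A) ^ (k+1) /
       ((C * K) ^ (2^(k+1) - k - 2) * (ln (real (card A))) ^ (2^(k+2) - k - 4))"
proof (intro exI[of _ 1024] conjI allI impI)
  fix k :: nat and I :: "real set" and f :: "real \<Rightarrow> real" and A :: "real set" and K :: real
  assume *: "k \<ge> 1 \<and> is_interval I \<and> k_convex k f I \<and> finite A \<and> A \<subseteq> I \<and>
     card A > 10 * k \<and> K > 0 \<and> real (card (sumdiff 2 1 A)) \<le> K * real (card A)"
  define P where "P = (1024 * K) ^ (2^(k+1) - k - 2)"
  define l where "l = ln (real (card A)) ^ (2^(k+2) - k - 4)"
  define s where "s = real (card (sumdiff (2^k) (2^k - 1) (f ` A)))"
  have "P > 0"
    using * by (simp add: P_def)
  \<comment> \<open>From \<open>k \<ge> 1\<close> the set has more than 10 elements, while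
    \<open>exp 1 \<le> 3\<close>.\<close>
  have "exp 1 \<le> real (card A)"
    using * exp_le by linarith
  then have "1 \<le> ln (real (card A))"
    using * by (subst ln_ge_iff) auto
  then have "1 \<le> l"
    by (simp add: l_def one_le_power)
  have "card (squeezed k (f ` A)) \<le> card (sumdiff (2^k) (2^k - 1) (f ` A))"
    using * by (intro card_mono) (auto simp: squeezed_def finite_sumdiff)
  have "A \<noteq> {}"
    using * by auto
  then have "real (card A) ^ (k + 1) \<le> P * card (squeezed k (f ` A))"
    unfolding P_def using * by (intro card_squeezed_ge) auto
  also have "\<dots> \<le> P * s"
    unfolding s_def using \<open>P > 0\<close> \<open>card (squeezed k (f ` A)) \<le> _\<close> by (intro mult_left_mono) auto
  also have "\<dots> \<le> P * s * l"
    using mult_left_mono[OF \<open>1 \<le> l\<close>, of "P * s"] \<open>P > 0\<close> by (simp add: s_def)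
  finally have "real (card A) ^ (k + 1) / (P * l) \<le> s"
    using \<open>P > 0\<close> \<open>1 \<le> l\<close> by (simp add: divide_simps mult_ac)
  then show "real (card (sumdiff (2^k) (2^k - 1) (f ` A))) \<ge> real (card A) ^ (k+1) /
       ((1024 * K) ^ (2^(k+1) - k - 2) * (ln (real (card A))) ^ (2^(k+2) - k - 4))"
    by (simp add: P_def l_def s_def)
qed simp

end
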